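(* Let $\lambda_1 \geq \lambda_2 \geq \ldots \geq \lambda_n$ be real numbers and let $r$ be the greatest index with $\lambda_r \geq 0$. If the condition $$\lambda_1 + \lambda_{r+1} + \ldots + \lambda_n \geq 0$$ is satisfied, then there exists an $n\times n$ nonnegative matrix with $\sigma = \{\lambda_1,\ldots,\lambda_n\}$ as its spectrum. Indeed, the nonnegative matrix can also be chosen to be a symmetric matrix.
   Context: A real $n\times n$ matrix is called nonnegative if each of its entries is nonnegative. The spectrum is understood as the list of eigenvalues counted with multiplicity. It is implicit in the definition of $r$ that some $\lambda_i\ge 0$ exists (i.e. $\lambda_1\ge 0$). When $r=n$ the sum $\lambda_{r+1}+\ldots+\lambda_n$ is empty and the condition reads $\lambda_1\geq 0$. *)

theory Defs
  imports "Jordan_Normal_Form.Char_Poly" "HOL-Library.Multiset"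
begin

definition nonneg_mat :: "real mat \<Rightarrow> bool" where
  "nonneg_mat A \<longleftrightarrow> (\<forall>i < dim_row A. \<forall>j < dim_col A. A $$ (i, j) \<ge> 0)"

definition symmetric_mat :: "'a mat \<Rightarrow> bool" where
  "symmetric_mat A \<longleftrightarrow> transpose_mat A = A"

(* The eigenvalues are taken over the complex numbers, so that no non-real
   eigenvalue of a real matrix is lost; each is counted with its algebraic multiplicity. *)
definition spectrum_mset :: "real mat \<Rightarrow> complex multiset" where
  "spectrum_mset A = proots (char_poly (map_mat complex_of_real A))"

end

theory Submission
  imports Defs
begin

text \<open>
  The symmetric matrix is built one eigenvalue at a time, following an idea of Fiedler.  Let \<open>A\<close>
  be symmetric and \<open>A u = \<alpha> u\<close> with \<open>u \<noteq> 0\<close>, and border \<open>A\<close> by the column \<open>u\<close>, the row \<open>u\<^sup>T\<close>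
  and the corner entry \<open>c\<close>.  The bordered matrix keeps every eigenvalue of \<open>A\<close> except one copy
  of \<open>\<alpha>\<close>, and gains the two roots of \<open>(x - c) (x - \<alpha>) - u\<^sup>T u\<close>; this is
  \<open>char_poly_border_mat\<close>.

  Write \<open>a = \<lambda>\<^sub>1\<close> and let \<open>m\<close> be one of the negative eigenvalues still to be realized.  If
  \<open>A\<close> is a nonnegative matrix that realizes \<open>a + m\<close> together with the other negative eigenvalues
  (the hypothesis on the sum is the same for this shorter list), scale a nonnegative eigenvector
  of \<open>A\<close> for \<open>a + m\<close> to squared length \<open>- a m\<close> and border with corner 0.  The quadratic becomes
  \<open>x\<^sup>2 - (a + m) x + a m = (x - a) (x - m)\<close>, so \<open>a + m\<close> is split into \<open>a\<close> and \<open>m\<close>.  The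
  bordered matrix again has a nonnegative eigenvector, now for \<open>a\<close>, and the induction in
  \<open>one_dominant_realization\<close> continues.  It is the condition
  \<open>\<lambda>\<^sub>1 + \<lambda>\<^sub>r\<^sub>+\<^sub>1 + \<dots> + \<lambda>\<^sub>n \<ge> 0\<close> that keeps the dominant eigenvalue nonnegative all
  the way down to the matrix of size one.

  The remaining eigenvalues \<open>\<lambda>\<^sub>2, \<dots>, \<lambda>\<^sub>r\<close> are nonnegative and are put on the diagonal,
  which is bordering by the zero column.
\<close>

section \<open>Bordering a matrix along an eigenvector\<close>

text \<open>
  An eigenvector in the border lets the last column be cleared: multiply on the right by the
  block matrix with rows \<open>(1, - u)\<close> and \<open>(0, t)\<close>.  The factor \<open>t\<close> on the left-hand side is
  the determinant of that multiplier; keeping it there avoids dividing by \<open>t\<close>, so that the ring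
  may consist of polynomials.
\<close>
lemma det_border_eigenvector:
  fixes B :: "'a :: idom mat"
  assumes B: "B \<in> carrier_mat n n" and u: "u \<in> carrier_mat n 1" and w: "w \<in> carrier_mat 1 n"
    and eigen: "B * u = t \<cdot>\<^sub>m u"
  shows "det (four_block_mat B u w (d \<cdot>\<^sub>m 1\<^sub>m 1)) * t = det B * (d * t - (w * u) $$ (0, 0))"
proof -
  let ?M = "four_block_mat B u w (d \<cdot>\<^sub>m 1\<^sub>m 1)"
  let ?P = "four_block_mat (1\<^sub>m n) (- u) (0\<^sub>m 1 n) (t \<cdot>\<^sub>m 1\<^sub>m 1)"
  let ?D = "(d * t - (w * u) $$ (0, 0)) \<cdot>\<^sub>m 1\<^sub>m 1"
  have detP: "det ?P = t"
    using u by (subst det_four_block_mat_lower_left_zero[of _ n _ 1]) (auto simp: det_single)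
  have upper: "B * (- u) + u * (t \<cdot>\<^sub>m 1\<^sub>m 1) = 0\<^sub>m n 1"
  proof -
    have "B * (- u) = - (t \<cdot>\<^sub>m u)"
      using B u eigen by (simp add: uminus_mult_right_mat)
    moreover have "u * (t \<cdot>\<^sub>m 1\<^sub>m 1) = t \<cdot>\<^sub>m u"
      using u mult_smult_distrib[OF u, of "1\<^sub>m 1" 1 t] by simp
    ultimately show ?thesis using u by (simp add: uminus_l_inv_mat[of _ n 1])
  qed
  have lower: "w * (- u) + (d \<cdot>\<^sub>m 1\<^sub>m 1) * (t \<cdot>\<^sub>m 1\<^sub>m 1) = ?D"
    using u w by (intro eq_matI) (auto simp: scalar_prod_def sum_negf)
  have "?M * ?P = four_block_mat (B * 1\<^sub>m n + u * 0\<^sub>m 1 n) (B * (- u) + u * (t \<cdot>\<^sub>m 1\<^sub>m 1))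
      (w * 1\<^sub>m n + (d \<cdot>\<^sub>m 1\<^sub>m 1) * 0\<^sub>m 1 n) (w * (- u) + (d \<cdot>\<^sub>m 1\<^sub>m 1) * (t \<cdot>\<^sub>m 1\<^sub>m 1))"
    using B u w by (intro mult_four_block_mat) auto
  also have "\<dots> = four_block_mat B (0\<^sub>m n 1) w ?D"
    unfolding upper lower using B u w by (intro cong_four_block_mat) auto
  finally have "det ?M * det ?P = det (four_block_mat B (0\<^sub>m n 1) w ?D)"
    using B u w by (subst det_mult[symmetric, of _ "n + 1"]) auto
  also have "\<dots> = det B * det ?D"
    using B w by (intro det_four_block_mat_upper_right_zero[of _ n _ 1]) auto
  finally show ?thesis unfolding detP by (simp add: det_single)
qed

definition border_mat :: "'a :: comm_ring_1 mat \<Rightarrow> 'a mat \<Rightarrow> 'a \<Rightarrow> 'a mat" where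
  "border_mat A u c = four_block_mat A u (transpose_mat u) (c \<cdot>\<^sub>m 1\<^sub>m 1)"

lemma border_mat_carrier:
  "A \<in> carrier_mat n n \<Longrightarrow> border_mat A u c \<in> carrier_mat (Suc n) (Suc n)"
  unfolding border_mat_def using four_block_carrier_mat[of A n n "c \<cdot>\<^sub>m 1\<^sub>m 1" 1 1] by simp

text \<open>
  An eigenvector of \<open>A\<close> for \<open>a\<close> is, over the polynomial ring, an eigenvector of \<open>x 1 - A\<close> for
  \<open>x - a\<close>, so the previous lemma applies to the characteristic matrix.  Since \<open>u\<close> need not have
  unit length, its square enters as \<open>u\<^sup>T u\<close>, and even \<open>u = 0\<close> is covered, with any \<open>a\<close>.
\<close>
lemma char_poly_border_mat:
  fixes A :: "'a :: idom mat"
  assumes A: "A \<in> carrier_mat n n" and u: "u \<in> carrier_mat n 1"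
    and eigen: "A * u = a \<cdot>\<^sub>m u"
  shows "char_poly (border_mat A u c) * [:- a, 1:]
       = char_poly A * ([:- c, 1:] * [:- a, 1:] - [:(transpose_mat u * u) $$ (0, 0):])"
proof -
  let ?v = "map_mat (\<lambda>x. [:- x:]) u"
  let ?B = "char_poly_matrix A"
  have block: "char_poly_matrix (border_mat A u c)
      = four_block_mat ?B ?v (transpose_mat ?v) ([:- c, 1:] \<cdot>\<^sub>m 1\<^sub>m 1)"
    using A u unfolding border_mat_def char_poly_matrix_def
    by (intro eq_matI) (auto simp: less_Suc_eq)
  have eigenB: "?B * ?v = [:- a, 1:] \<cdot>\<^sub>m ?v"
  proof (rule eq_matI)
    fix i j assume "i < dim_row ([:- a, 1:] \<cdot>\<^sub>m ?v)" and "j < dim_col ([:- a, 1:] \<cdot>\<^sub>m ?v)"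
    then have i: "i < n" and j: "j = 0" using u by auto
    have "(A * u) $$ (i, 0) = a * u $$ (i, 0)" using i u by (simp add: eigen)
    then have sum: "(\<Sum>k = 0..<n. A $$ (i, k) * u $$ (k, 0)) = a * u $$ (i, 0)"
      using A u i by (simp add: scalar_prod_def)
    have "(?B * ?v) $$ (i, 0) = (\<Sum>k = 0..<n. ?B $$ (i, k) * [:- (u $$ (k, 0)):])"
      using u i by (simp add: scalar_prod_def carrier_matD[OF char_poly_matrix_closed[OF A]])
    \<comment> \<open>Only the diagonal entry of the characteristic matrix contains the variable.\<close>
    also have "\<dots> = (\<Sum>k = 0..<n. (if k = i then [:0, - (u $$ (i, 0)):] else 0)
        + [:A $$ (i, k) * u $$ (k, 0):])"
      using A u i by (intro sum.cong) (auto simp: char_poly_matrix_def)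
    also have "\<dots> = [:0, - (u $$ (i, 0)):] + [:a * u $$ (i, 0):]"
      using i by (simp add: sum.distrib sum sum_to_poly)
    finally show "(?B * ?v) $$ (i, j) = ([:- a, 1:] \<cdot>\<^sub>m ?v) $$ (i, j)"
      using i j u by simp
  qed (use A u in \<open>auto simp: char_poly_matrix_def\<close>)
  have norm: "(transpose_mat ?v * ?v) $$ (0, 0) = [:(transpose_mat u * u) $$ (0, 0):]"
    using u by (simp add: scalar_prod_def flip: sum_to_poly)
  show ?thesis
    unfolding char_poly_def block
    by (subst det_border_eigenvector[of _ n]) (use A u eigenB norm in auto)
qed

lemma border_mat_nonneg:
  assumes "A \<in> carrier_mat n n" "u \<in> carrier_mat n 1"
    and "nonneg_mat A" "nonneg_mat u" "c \<ge> 0"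
  shows "nonneg_mat (border_mat A u c)"
  using assms unfolding nonneg_mat_def border_mat_def by (auto simp: less_Suc_eq)

lemma border_mat_symmetric:
  assumes "A \<in> carrier_mat n n" "u \<in> carrier_mat n 1" and "symmetric_mat A"
  shows "symmetric_mat (border_mat A u c)"
  using assms unfolding symmetric_mat_def border_mat_def
  by (subst transpose_four_block_mat[of _ n n _ 1 _ 1])
     (auto intro!: cong_four_block_mat)

section \<open>Realizing the spectrum\<close>

abbreviation root_poly :: "'a :: comm_ring_1 list \<Rightarrow> 'a poly" where
  "root_poly xs \<equiv> (\<Prod>x\<leftarrow>xs. [:- x, 1:])"

text \<open>
  Suleimanova's case, in which all eigenvalues but one are nonpositive.  The nonnegative
  eigenvector for \<open>a\<close> is part of the conclusion because the next step of the induction uses it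
  as the border; it is not normalized, and its squared length only has to be positive for it to
  be rescaled.
\<close>
lemma one_dominant_realization:
  fixes a :: real
  assumes "\<And>x. x \<in> set xs \<Longrightarrow> x \<le> 0" and "a + sum_list xs \<ge> 0"
  shows "\<exists>A u. A \<in> carrier_mat (Suc (length xs)) (Suc (length xs)) \<and>
    u \<in> carrier_mat (Suc (length xs)) 1 \<and> nonneg_mat A \<and> symmetric_mat A \<and> nonneg_mat u \<and>
    (transpose_mat u * u) $$ (0, 0) > 0 \<and> A * u = a \<cdot>\<^sub>m u \<and> char_poly A = root_poly (a # xs)"
  using assms
proof (induction xs arbitrary: a)
  case Nil
  have "char_poly (a \<cdot>\<^sub>m 1\<^sub>m 1) = [:- a, 1:]"
    by (simp add: char_poly_def char_poly_matrix_def det_single)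
  with Nil show ?case
    by (intro exI[of _ "a \<cdot>\<^sub>m 1\<^sub>m 1"] exI[of _ "1\<^sub>m 1"])
       (auto simp: nonneg_mat_def symmetric_mat_def)
next
  case (Cons m xs)
  let ?n = "Suc (length xs)"
  from Cons.prems have m: "m \<le> 0" and xs: "sum_list xs \<le> 0"
    by (auto intro: sum_list_nonpos)
  with Cons.prems(2) have a: "a \<ge> 0" and am: "a + m \<ge> 0" by simp_all
  from Cons.IH[of "a + m"] Cons.prems obtain A u
    where A: "A \<in> carrier_mat ?n ?n" and u: "u \<in> carrier_mat ?n 1"
      and nonneg: "nonneg_mat A" "nonneg_mat u" and sym: "symmetric_mat A"
      and pos: "(transpose_mat u * u) $$ (0, 0) > 0" and eigen: "A * u = (a + m) \<cdot>\<^sub>m u"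
      and char: "char_poly A = root_poly ((a + m) # xs)"
    by (auto simp: add.assoc)
  \<comment> \<open>The scaled border \<open>v\<close> has squared length \<open>- a m\<close>, and \<open>b\<close> is the entry that extends \<open>u\<close>
    to an eigenvector of the bordered matrix for \<open>a\<close>.  If \<open>a = 0\<close>, then \<open>m = 0\<close>, and division by
    zero yields \<open>b = 0\<close>, which is the right value: the border vanishes.\<close>
  define s where "s = (transpose_mat u * u) $$ (0, 0)"
  define \<rho> where "\<rho> = sqrt (- (a * m) / s)"
  define b where "b = \<rho> * s / a"
  define v where "v = \<rho> \<cdot>\<^sub>m u"
  define M where "M = border_mat A v 0"
  \<comment> \<open>The column \<open>u\<close> with \<open>b\<close> put below it, as a block matrix whose right blocks have width 0.\<close>
  define w where "w = four_block_mat u (0\<^sub>m ?n 0) (b \<cdot>\<^sub>m 1\<^sub>m 1) (0\<^sub>m 1 0)"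
  have s: "s > 0" using pos s_def by simp
  have \<rho>: "\<rho> \<ge> 0" "\<rho> * \<rho> * s = - (a * m)"
    using s a m by (auto simp: \<rho>_def mult_nonneg_nonpos divide_nonpos_pos)
  have b: "b \<ge> 0" using \<rho> s a by (simp add: b_def)
  have m0: "m = 0" if "a = 0" using that am m by simp
  have b\<rho>: "b * \<rho> = - m" using \<rho>(2) m0 by (cases "a = 0") (auto simp: b_def field_simps)
  have ab: "\<rho> * s = a * b" using \<rho>(2) s m0 by (cases "a = 0") (auto simp: b_def)
  have v: "v \<in> carrier_mat ?n 1" using u by (simp add: v_def)
  have vu: "transpose_mat v * u = (\<rho> * s) \<cdot>\<^sub>m 1\<^sub>m 1"
    using u by (intro eq_matI) (auto simp: v_def s_def scalar_prod_def sum_distrib_left distrib_left mult.assoc)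
  have eigen_v: "A * v = (a + m) \<cdot>\<^sub>m v"
    using u by (intro eq_matI) (auto simp: v_def mult_smult_distrib[OF A u] eigen)
  have vv: "(transpose_mat v * v) $$ (0, 0) = - (a * m)"
    using vu u \<rho>(2) unfolding v_def
    by (subst mult_smult_distrib[of _ 1 ?n _ 1]) (auto simp: mult.assoc)
  have "M * w = four_block_mat (A * u + v * (b \<cdot>\<^sub>m 1\<^sub>m 1)) (A * 0\<^sub>m ?n 0 + v * 0\<^sub>m 1 0)
      (transpose_mat v * u + (0 \<cdot>\<^sub>m 1\<^sub>m 1) * (b \<cdot>\<^sub>m 1\<^sub>m 1))
      (transpose_mat v * 0\<^sub>m ?n 0 + (0 \<cdot>\<^sub>m 1\<^sub>m 1) * 0\<^sub>m 1 0)"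
    unfolding M_def w_def border_mat_def using A u v by (intro mult_four_block_mat) auto
  also have "A * u + v * (b \<cdot>\<^sub>m 1\<^sub>m 1) = a \<cdot>\<^sub>m u"
  proof -
    have "v * (b \<cdot>\<^sub>m 1\<^sub>m 1) = (- m) \<cdot>\<^sub>m u"
      using v u by (intro eq_matI) (auto simp: mult_smult_distrib[OF v] v_def b\<rho> simp flip: mult.assoc)
    then show ?thesis using u by (intro eq_matI) (auto simp: eigen algebra_simps)
  qed
  also have "transpose_mat v * u + (0 \<cdot>\<^sub>m 1\<^sub>m 1) * (b \<cdot>\<^sub>m 1\<^sub>m 1) = a \<cdot>\<^sub>m (b \<cdot>\<^sub>m 1\<^sub>m 1)"
    unfolding vu by (intro eq_matI) (auto simp: ab)
  also have "four_block_mat (a \<cdot>\<^sub>m u) (A * 0\<^sub>m ?n 0 + v * 0\<^sub>m 1 0) (a \<cdot>\<^sub>m (b \<cdot>\<^sub>m 1\<^sub>m 1))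
      (transpose_mat v * 0\<^sub>m ?n 0 + (0 \<cdot>\<^sub>m 1\<^sub>m 1) * 0\<^sub>m 1 0) = a \<cdot>\<^sub>m w"
    unfolding w_def using A u v by (intro eq_matI) auto
  finally have eigen_w: "M * w = a \<cdot>\<^sub>m w" .
  have w: "w \<in> carrier_mat (Suc ?n) 1"
    using u four_block_carrier_mat[of u ?n 1 "0\<^sub>m 1 0" 1 0] by (simp add: w_def)
  have ww: "(transpose_mat w * w) $$ (0, 0) = s + b * b"
    using u by (auto simp: w_def s_def scalar_prod_def)
  have quadratic: "[:- 0, 1:] * [:- (a + m), 1:] - [:- (a * m):] = [:- a, 1:] * [:- m, 1:]"
    by simp
  have "char_poly M * [:- (a + m), 1:] = char_poly A * ([:- 0, 1:] * [:- (a + m), 1:] - [:- (a * m):])"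
    unfolding M_def using char_poly_border_mat[OF A v eigen_v, of 0] by (simp only: vv)
  also have "\<dots> = root_poly (a # m # xs) * [:- (a + m), 1:]"
    unfolding quadratic char by (simp only: list.map prod_list.Cons mult_ac)
  \<comment> \<open>The superseded eigenvalue \<open>a + m\<close> cancels as a linear factor, even if it is a multiple root.\<close>
  finally have "char_poly M = root_poly (a # m # xs)"
    by (subst (asm) mult_right_cancel) auto
  moreover have "nonneg_mat v" using nonneg(2) \<rho>(1) by (auto simp: v_def nonneg_mat_def)
  then have "nonneg_mat M" unfolding M_def using nonneg A v by (intro border_mat_nonneg) auto
  moreover have "nonneg_mat w"
    using nonneg(2) b u by (auto simp: w_def nonneg_mat_def)
  moreover have "symmetric_mat M" unfolding M_def using A v sym by (rule border_mat_symmetric)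
  moreover have "M \<in> carrier_mat (Suc ?n) (Suc ?n)" unfolding M_def by (rule border_mat_carrier[OF A])
  moreover have "s + b * b > 0" using s by (simp add: add_pos_nonneg)
  ultimately show ?case using w eigen_w ww
    by (intro exI[of _ M] exI[of _ w]) simp
qed

text \<open>
  Bordering by the zero column adds a diagonal entry, and the zero column satisfies the
  eigenvector equation for every number; in the proof that number is 0.
\<close>
lemma append_nonneg_eigenvalues:
  fixes A :: "real mat"
  assumes "A \<in> carrier_mat n n" "nonneg_mat A" "symmetric_mat A"
    and "char_poly A = root_poly xs" and "\<And>y. y \<in> set ys \<Longrightarrow> y \<ge> 0"
  shows "\<exists>B \<in> carrier_mat (length ys + n) (length ys + n). nonneg_mat B \<and> symmetric_mat B \<and>
    char_poly B = root_poly (ys @ xs)"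
  using assms
proof (induction ys)
  case (Cons y ys)
  let ?n = "length ys + n"
  from Cons obtain B where B: "B \<in> carrier_mat ?n ?n" "nonneg_mat B" "symmetric_mat B"
    and char: "char_poly B = root_poly (ys @ xs)" by auto
  let ?u = "0\<^sub>m ?n 1"
  have "char_poly (border_mat B ?u y) * [:- 0, 1:]
      = char_poly B * ([:- y, 1:] * [:- 0, 1:] - [:(transpose_mat ?u * ?u) $$ (0, 0):])"
    using B(1) by (intro char_poly_border_mat) auto
  also have "\<dots> = root_poly ((y # ys) @ xs) * [:- 0, 1:]"
    by (simp add: char algebra_simps)
  finally have "char_poly (border_mat B ?u y) = root_poly ((y # ys) @ xs)"
    by (subst (asm) mult_right_cancel) auto
  moreover have "nonneg_mat (border_mat B ?u y)"
    using B Cons.prems by (intro border_mat_nonneg[of _ ?n]) (auto simp: nonneg_mat_def)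
  moreover have "symmetric_mat (border_mat B ?u y)"
    using B by (intro border_mat_symmetric[of _ ?n]) auto
  ultimately show ?case using border_mat_carrier[OF B(1), of ?u y] by auto
qed auto

lemma spectrum_mset_root_poly:
  assumes "A \<in> carrier_mat n n" and "char_poly A = root_poly xs"
  shows "spectrum_mset A = mset (map complex_of_real xs)"
proof -
  have "map_poly complex_of_real (root_poly xs) = root_poly (map complex_of_real xs)"
  proof (induction xs)
    case (Cons x xs)
    interpret map_poly_hom: map_poly_comm_ring_hom complex_of_real ..
    from Cons show ?case by (simp add: map_poly_hom.hom_mult del: mult_pCons_left)
  qed simp
  then have "char_poly (map_mat complex_of_real A) = root_poly (map complex_of_real xs)"
    using assms by (simp add: of_real_hom.char_poly_hom)
  moreover have "proots (root_poly ys) = mset ys" for ys :: "complex list"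
  proof (induction ys)
    case (Cons y ys)
    have "root_poly ys \<noteq> 0" by (auto simp: prod_list_zero_iff)
    then have "proots ([:- y, 1:] * root_poly ys) = {#y#} + mset ys"
      by (subst proots_mult) (use Cons in auto)
    then show ?case by simp
  qed auto
  ultimately show ?thesis by (simp only: spectrum_mset_def)
qed

theorem theorem3p3:
  fixes n r :: nat and l :: "nat \<Rightarrow> real"
  assumes decreasing: "\<And>i j. 1 \<le> i \<Longrightarrow> i \<le> j \<Longrightarrow> j \<le> n \<Longrightarrow> l j \<le> l i"
    and r_index: "r \<in> {1..n}" "l r \<ge> 0"
    and r_greatest: "\<And>i. i \<in> {1..n} \<Longrightarrow> l i \<ge> 0 \<Longrightarrow> i \<le> r"
    and condition: "l 1 + (\<Sum>i = r + 1..n. l i) \<ge> 0"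
  shows "(\<exists>A \<in> carrier_mat n n. nonneg_mat A \<and>
             spectrum_mset A = {# complex_of_real (l i). i \<in># mset_set {1..n} #})
       \<and> (\<exists>A \<in> carrier_mat n n. nonneg_mat A \<and> symmetric_mat A \<and>
             spectrum_mset A = {# complex_of_real (l i). i \<in># mset_set {1..n} #})"
proof -
  define pos where "pos = map l [2..<r + 1]"
  define neg where "neg = map l [r + 1..<n + 1]"
  have "l i \<le> 0" if "i \<in> {r + 1..n}" for i
    using r_greatest[of i] that by (cases "l i \<ge> 0") auto
  then have neg_le: "\<And>x. x \<in> set neg \<Longrightarrow> x \<le> 0" by (auto simp: neg_def)
  have "sum_list neg = (\<Sum>i = r + 1..n. l i)"
    unfolding neg_def by (subst sum_list_distinct_conv_sum_set) (auto intro!: sum.cong)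
  with condition have "l 1 + sum_list neg \<ge> 0" by simp
  from one_dominant_realization[OF neg_le this] obtain A
    where A: "A \<in> carrier_mat (Suc (length neg)) (Suc (length neg))" "nonneg_mat A"
      "symmetric_mat A" "char_poly A = root_poly (l 1 # neg)" by blast
  have "0 \<le> l i" if "i \<in> {2..r}" for i
    using decreasing[of i r] r_index that by auto
  then have pos_ge: "\<And>y. y \<in> set pos \<Longrightarrow> y \<ge> 0" by (auto simp: pos_def)
  from append_nonneg_eigenvalues[OF A pos_ge] obtain B
    where B: "B \<in> carrier_mat (length pos + Suc (length neg)) (length pos + Suc (length neg))"
      "nonneg_mat B" "symmetric_mat B" and char: "char_poly B = root_poly (pos @ l 1 # neg)"
    by blast
  have n: "length pos + Suc (length neg) = n"
    using r_index by (auto simp: pos_def neg_def)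
  have idx: "[1..<n + 1] = 1 # [2..<r + 1] @ [r + 1..<n + 1]"
  proof -
    have "[1..<n + 1] = 1 # [2..<n + 1]"
      using upt_conv_Cons[of 1 "n + 1"] r_index by (simp add: numeral_2_eq_2 del: upt_Suc)
    moreover have "[2..<n + 1] = [2..<r + 1] @ [r + 1..<n + 1]"
      using r_index upt_add_eq_append[of 2 "r + 1" "n - r"] by (auto simp del: upt_Suc)
    ultimately show ?thesis by (simp only:)
  qed
  have "mset_set {1..n} = mset [1..<n + 1]"
    by (metis mset_upt atLeastLessThanSuc_atLeastAtMost Suc_eq_plus1)
  then have "spectrum_mset B = {# complex_of_real (l i). i \<in># mset_set {1..n} #}"
    unfolding spectrum_mset_root_poly[OF B(1) char]
    by (simp only: idx) (simp add: pos_def neg_def image_mset.compositionality o_def del: upt_Suc)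
  with B n show ?thesis by auto
qed

end
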